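(* Let $G$ be a minimum counterexample to Reed's conjecture; that is, $G$ is a graph with $\chi(G) > \left\lceil \frac{\omega(G) + \Delta(G) + 1}{2}\right\rceil$, and every graph $H$ with fewer vertices than $G$ satisfies $\chi(H) \leq \left\lceil \frac{\omega(H) + \Delta(H) + 1}{2}\right\rceil$. Then $\omega(G) < \frac{3}{4}(\Delta(G) + 1)$, and hence also $\chi(G) > \left\lceil \frac{7}{6}\omega(G) \right\rceil$.
   Context: Graphs are finite, simple and undirected. $\chi(G)$ denotes the chromatic number of $G$, $\omega(G)$ the clique number (the number of vertices in a largest clique), and $\Delta(G)$ the maximum degree. Reed's conjecture asserts that every graph $G$ satisfies $\chi(G) \leq \left\lceil \frac{\omega(G) + \Delta(G) + 1}{2}\right\rceil$. *)

theory Defs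
  imports Complex_Main "Graph_Theory.Pair_Digraph"
begin

text \<open>
  A finite simple undirected graph is a \<^locale>\<open>pair_graph\<close>: a finite vertex set with a symmetric,
  irreflexive set of ordered pairs, each edge being represented by both of its orientations.
\<close>

definition is_clique :: "'a pair_pre_digraph \<Rightarrow> 'a set \<Rightarrow> bool" where
  "is_clique G K \<longleftrightarrow> K \<subseteq> pverts G \<and> (\<forall>u\<in>K. \<forall>v\<in>K. u \<noteq> v \<longrightarrow> (u, v) \<in> parcs G)"

definition clique_number :: "'a pair_pre_digraph \<Rightarrow> nat" where
  "clique_number G = Max (card ` {K. is_clique G K})"

text \<open>
  In a \<^locale>\<open>pair_graph\<close> every edge at a vertex contributes exactly one outgoing arc, so the out-degree
  is the degree. The inserted 0 only matters for the graph without vertices.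
\<close>

definition max_degree :: "'a pair_pre_digraph \<Rightarrow> nat" where
  "max_degree G = Max (insert 0 (out_degree (with_proj G) ` pverts G))"

definition proper_colouring :: "'a pair_pre_digraph \<Rightarrow> nat \<Rightarrow> ('a \<Rightarrow> nat) \<Rightarrow> bool" where
  "proper_colouring G k c \<longleftrightarrow>
     (\<forall>v\<in>pverts G. c v < k) \<and> (\<forall>(u, v)\<in>parcs G. c u \<noteq> c v)"

definition chromatic_number :: "'a pair_pre_digraph \<Rightarrow> nat" where
  "chromatic_number G = (LEAST k. \<exists>c. proper_colouring G k c)"

definition satisfies_reed :: "'a pair_pre_digraph \<Rightarrow> bool" where
  "satisfies_reed G \<longleftrightarrow>
     int (chromatic_number G) \<le> \<lceil>(real (clique_number G) + real (max_degree G) + 1) / 2\<rceil>"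

text \<open>
  Letting H range over graphs on the vertex type of G loses no generality: a graph with fewer
  vertices than G is isomorphic to one whose vertices are vertices of G.
\<close>

definition minimum_reed_counterexample :: "'a pair_pre_digraph \<Rightarrow> bool" where
  "minimum_reed_counterexample G \<longleftrightarrow>
     pair_graph G \<and> \<not> satisfies_reed G \<and>
     (\<forall>H :: 'a pair_pre_digraph.
        pair_graph H \<and> card (pverts H) < card (pverts G) \<longrightarrow> satisfies_reed H)"

end

theory Submission
  imports Defs "HOL-Library.Disjoint_Sets"
begin

text \<open>
  Write \<open>\<omega>\<close>, \<open>\<Delta>\<close>, \<open>\<chi>\<close> for the clique number, maximum degree and chromatic number of \<open>G\<close>, and suppose
  \<open>\<omega> \<ge> 3 (\<Delta> + 1) / 4\<close>. The point is that some independent set \<open>I\<close> then meets every maximum clique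
  (\<open>ex_independent_hitting_max_cliques\<close>). Enlarge \<open>I\<close> to a maximal independent set. Deleting it
  costs one colour, while both \<open>\<omega>\<close> and \<open>\<Delta>\<close> drop by at least one (if any vertex is left), so Reed's
  bound for \<open>G - I\<close> gives Reed's bound for \<open>G\<close> (\<open>satisfies_reed_if_smaller\<close>). Hence a minimum
  counterexample has \<open>\<Delta> + 1 > 4 \<omega> / 3\<close>, and inserting this into \<open>\<chi> > \<lceil>(\<omega> + \<Delta> + 1) / 2\<rceil>\<close> gives
  \<open>\<chi> > \<lceil>7 \<omega> / 6\<rceil>\<close>.

  To find \<open>I\<close>, consider the maximum cliques. Hajnal's lemma (\<open>hajnal\<close>), \<open>|\<Inter>Q| + |\<Union>Q| \<ge> 2\<omega>\<close> for every
  nonempty family \<open>Q\<close> of maximum cliques, shows that for \<open>\<omega> > 2 (\<Delta> + 1) / 3\<close> intersecting is an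
  equivalence relation on maximum cliques (\<open>max_cliques_meet_trans\<close>) and that the cliques of one
  equivalence class \<open>c\<close> have a common vertex (\<open>kostochka\<close>), so at least \<open>2\<omega> - (\<Delta> + 1)\<close> common
  vertices. A vertex of \<open>\<Inter>c\<close> has at most \<open>\<Delta> + 1 - \<omega>\<close> neighbours outside \<open>\<Union>c\<close>. For
  \<open>\<omega> \<ge> 3 (\<Delta> + 1) / 4\<close> the sets \<open>\<Inter>c\<close> are therefore at least twice as large as the degrees between
  them, and Haxell's theorem (\<open>haxell\<close>) selects one vertex from each so that the result is
  independent. The argument is due to Rabern.
\<close>

section \<open>Independent transversals\<close>

text \<open>
  A choice of one vertex \<open>t i\<close> from each part \<open>V i\<close>, \<open>i \<in> J\<close>, no two of them \<open>E\<close>-adjacent.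
  Edges inside a part play no role when the parts are disjoint.
\<close>
definition indep_transversal :: "('a \<Rightarrow> 'a \<Rightarrow> bool) \<Rightarrow> ('i \<Rightarrow> 'a set) \<Rightarrow> 'i set \<Rightarrow> ('i \<Rightarrow> 'a) \<Rightarrow> bool" where
  "indep_transversal E V J t \<longleftrightarrow>
     (\<forall>i\<in>J. t i \<in> V i) \<and> (\<forall>i\<in>J. \<forall>j\<in>J. i \<noteq> j \<longrightarrow> \<not> E (t i) (t j))"

lemma indep_transversal_update:
  assumes "indep_transversal E V J t" "symp E" "y \<in> V i" "\<And>j. j \<in> J \<Longrightarrow> \<not> E y (t j)"
  shows "indep_transversal E V (insert i J) (t(i := y))"
proof -
  have "\<not> E (t j) y" if "j \<in> J" for j using assms(2,4) that by (blast dest: sympD)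
  then show ?thesis using assms(1,3,4) by (simp add: indep_transversal_def)
qed

lemma ex_undominated:
  assumes "finite S" "disjoint_family_on V S" "\<And>i. i \<in> S \<Longrightarrow> finite (V i) \<and> m \<le> card (V i)"
    and "finite D" "\<And>u. u \<in> D \<Longrightarrow> card {v \<in> \<Union>(V ` S). E u v} \<le> d"
    and "card D * d < card S * m"
  shows "\<exists>v\<in>\<Union>(V ` S). \<forall>u\<in>D. \<not> E u v"
proof (rule ccontr)
  assume "\<not> ?thesis"
  then have "\<Union>(V ` S) \<subseteq> (\<Union>u\<in>D. {v \<in> \<Union>(V ` S). E u v})" by blast
  moreover have "finite (\<Union>u\<in>D. {v \<in> \<Union>(V ` S). E u v})" using assms by auto
  ultimately have "card (\<Union>(V ` S)) \<le> card (\<Union>u\<in>D. {v \<in> \<Union>(V ` S). E u v})"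
    by (rule card_mono[rotated])
  also have "\<dots> \<le> (\<Sum>u\<in>D. card {v \<in> \<Union>(V ` S). E u v})" using assms(4) by (rule card_UN_le)
  also have "\<dots> \<le> card D * d" using sum_bounded_above[of D _ d] assms(5) by simp
  also have "\<dots> < card S * m" by fact
  also have "\<dots> \<le> (\<Sum>i\<in>S. card (V i))" using sum_bounded_below[of S m] assms(3) by simp
  also have "\<dots> = card (\<Union>(V ` S))"
    using assms by (intro card_UN_disjoint[symmetric]) (auto simp: disjoint_family_on_def)
  finally show False by simp
qed

text \<open>
  The state of Haxell's alternating construction after \<open>k\<close> steps. The transversal \<open>t\<close> covers \<open>J\<close>;
  the block \<open>W l\<close> consists of the parts whose chosen vertex is adjacent to the vertex \<open>x l\<close> of \<open>X\<close>.
  By the last condition, no transversal that leaves the earlier blocks unchanged makes \<open>W l\<close>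
  smaller.
\<close>
definition alternating_blocks ::
  "('a \<Rightarrow> 'a \<Rightarrow> bool) \<Rightarrow> ('i \<Rightarrow> 'a set) \<Rightarrow> 'i set \<Rightarrow> 'a set \<Rightarrow> nat \<Rightarrow> (nat \<Rightarrow> 'a) \<Rightarrow> (nat \<Rightarrow> 'i set)
    \<Rightarrow> ('i \<Rightarrow> 'a) \<Rightarrow> bool" where
  "alternating_blocks E V J X k x W t \<longleftrightarrow>
     indep_transversal E V J t \<and>
     (\<forall>l<k. x l \<in> X \<and> W l \<noteq> {} \<and> W l = {i\<in>J. E (x l) (t i)}) \<and>
     disjoint_family_on W {..<k} \<and>
     (\<forall>l<k. \<forall>t'. indep_transversal E V J t' \<longrightarrow>
        (\<forall>m<l. (\<forall>i\<in>W m. t' i = t i) \<and> W m = {i\<in>J. E (x m) (t' i)}) \<longrightarrow>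
        card (W l) \<le> card {i\<in>J. E (x l) (t' i)})"

lemma alternating_blocks_card:
  assumes "alternating_blocks E V J X k x W t" "finite J"
  shows "k \<le> card (\<Union>(W ` {..<k}))" "\<Union>(W ` {..<k}) \<subseteq> J"
proof -
  have W: "W l \<noteq> {}" "W l = {i\<in>J. E (x l) (t i)}" if "l < k" for l
    using assms(1) that unfolding alternating_blocks_def by (elim conjE; blast)+
  have disj: "disjoint_family_on W {..<k}" using assms(1) by (simp add: alternating_blocks_def)
  from W(2) show sub: "\<Union>(W ` {..<k}) \<subseteq> J" by auto
  then have fin: "finite (W l)" if "l < k" for l
    using that assms(2) by (meson UN_subset_iff finite_subset lessThan_iff)
  have "k = (\<Sum>l<k. 1)" by simp
  also have "\<dots> \<le> (\<Sum>l<k. card (W l))"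
    using W(1) fin by (intro sum_mono) (simp add: Suc_le_eq card_gt_0_iff)
  also have "\<dots> = card (\<Union>(W ` {..<k}))"
    using disj fin by (intro card_UN_disjoint[symmetric]) (simp_all add: disjoint_family_on_def)
  finally show "k \<le> card (\<Union>(W ` {..<k}))" .
qed

text \<open>
  A vertex \<open>y\<close> of the missing part \<open>a\<close> or of a part in some block, adjacent neither to the \<open>x l\<close> nor
  to the chosen vertices of the blocks, starts a new block: if no chosen vertex at all were adjacent
  to \<open>y\<close>, then choosing \<open>y\<close> in its own part would either extend the transversal to \<open>a\<close> or shrink an
  earlier block.
\<close>
lemma alternating_blocks_extend:
  assumes blocks: "alternating_blocks E V J X k x W t" and J: "finite J" and sym: "symp E"
    and none: "\<nexists>t. indep_transversal E V (insert a J) t"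
    and y: "y \<in> X" "i \<in> insert a (\<Union>(W ` {..<k}))" "y \<in> V i"
    and undom: "\<And>l. l < k \<Longrightarrow> \<not> E (x l) y" "\<And>l j. l < k \<Longrightarrow> j \<in> W l \<Longrightarrow> \<not> E (t j) y"
  shows "\<exists>x' W' t'. alternating_blocks E V J X (Suc k) x' W' t'"
proof -
  define ok where "ok l t' \<longleftrightarrow> indep_transversal E V J t' \<and>
      (\<forall>m<l. (\<forall>i\<in>W m. t' i = t i) \<and> W m = {i\<in>J. E (x m) (t' i)})" for l t'
  define N where "N t' = {i\<in>J. E y (t' i)}" for t'
  have it: "indep_transversal E V J t" and xX: "\<And>l. l < k \<Longrightarrow> x l \<in> X"
    and Wne: "\<And>l. l < k \<Longrightarrow> W l \<noteq> {}" and Wt: "\<And>l. l < k \<Longrightarrow> W l = {i\<in>J. E (x l) (t i)}"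
    and disj: "disjoint_family_on W {..<k}"
    and minimal: "\<And>l t'. l < k \<Longrightarrow> ok l t' \<Longrightarrow> card (W l) \<le> card {i\<in>J. E (x l) (t' i)}"
    using blocks unfolding alternating_blocks_def ok_def by (elim conjE; blast)+
  have "ok k t" unfolding ok_def using it Wt by simp
  from ex_has_least_nat[of "ok k", OF this, of "\<lambda>t'. card (N t')"]
  obtain s where s: "ok k s" and s_min: "\<And>t'. ok k t' \<Longrightarrow> card (N s) \<le> card (N t')"
    by blast
  have s_it: "indep_transversal E V J s" and s_t: "\<And>l j. l < k \<Longrightarrow> j \<in> W l \<Longrightarrow> s j = t j"
    and s_W: "\<And>l. l < k \<Longrightarrow> W l = {i\<in>J. E (x l) (s i)}"
    using s unfolding ok_def by blast+
  have N_ne: "N s \<noteq> {}"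
  proof
    assume "N s = {}"
    then have free: "\<And>j. j \<in> J \<Longrightarrow> \<not> E y (s j)" unfolding N_def by blast
    have new: "indep_transversal E V (insert i J) (s(i := y))"
      using s_it sym y(3) free by (rule indep_transversal_update)
    then have "i \<noteq> a" using none by blast
    then obtain l where l: "l < k" "i \<in> W l" using y(2) by blast
    have "i \<in> J" using l s_W by blast
    have notin: "i \<notin> W m" if "m < l" for m
      using disjoint_family_onD[OF disj, of m l] l that by auto
    \<comment> \<open>The exchange affects none of the blocks before \<open>W l\<close>, and removes \<open>i\<close> from \<open>W l\<close>.\<close>
    have W_new: "{j\<in>J. E (x m) ((s(i := y)) j)} = W m - {i}" if "m < k" for m
      unfolding s_W[OF that] using undom(1)[OF that] by auto
    have "ok l (s(i := y))"
      unfolding ok_def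
    proof (intro conjI allI impI)
      show "indep_transversal E V J (s(i := y))" using new \<open>i \<in> J\<close> by (simp add: insert_absorb)
      fix m assume m: "m < l"
      then have mk: "m < k" using l by simp
      show "\<forall>j\<in>W m. (s(i := y)) j = t j" using notin[OF m] s_t[OF mk] by auto
      show "W m = {j\<in>J. E (x m) ((s(i := y)) j)}"
        unfolding W_new[OF mk] using notin[OF m] by blast
    qed
    from minimal[OF l(1) this] have "card (W l) \<le> card (W l - {i})" unfolding W_new[OF l(1)] .
    moreover have "finite (W l)" using s_W[OF l(1)] J by simp
    ultimately show False using l(2) by (meson card_Diff1_less linorder_not_less)
  qed
  have N_disj: "N s \<inter> W l = {}" if "l < k" for l
  proof (rule equals0I)
    fix j assume "j \<in> N s \<inter> W l"
    then have "E y (t j)" "j \<in> W l" using s_t[OF that, of j] by (simp_all add: N_def)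
    then show False using undom(2)[OF that] sympD[OF sym] by blast
  qed
  have "alternating_blocks E V J X (Suc k) (x(k := y)) (W(k := N s)) s"
    unfolding alternating_blocks_def
  proof (intro conjI allI impI)
    show "indep_transversal E V J s" by fact
    show "disjoint_family_on (W(k := N s)) {..<Suc k}"
      unfolding disjoint_family_on_def
    proof (intro ballI impI)
      fix m n assume "m \<in> {..<Suc k}" "n \<in> {..<Suc k}" "m \<noteq> n"
      then show "(W(k := N s)) m \<inter> (W(k := N s)) n = {}"
        using disjoint_family_onD[OF disj, of m n] N_disj[of m] N_disj[of n]
        by (auto simp: less_Suc_eq)
    qed
  next
    fix l assume "l < Suc k"
    then consider "l < k" | "l = k" by linarith
    then show "(x(k := y)) l \<in> X" "(W(k := N s)) l \<noteq> {}"
      "(W(k := N s)) l = {i \<in> J. E ((x(k := y)) l) (s i)}"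
      by (cases; use xX Wne s_W y N_ne in \<open>auto simp: N_def\<close>)+
  next
    fix l t' assume l: "l < Suc k" and t': "indep_transversal E V J t'"
      and agree: "\<forall>m<l. (\<forall>i\<in>(W(k := N s)) m. t' i = s i) \<and>
        (W(k := N s)) m = {i \<in> J. E ((x(k := y)) m) (t' i)}"
    have "ok l t'"
      unfolding ok_def
    proof (intro conjI allI impI t')
      fix m assume m: "m < l"
      then have mk: "m < k" using l by simp
      then have upd: "(W(k := N s)) m = W m" "(x(k := y)) m = x m" by simp_all
      have agree_m: "(\<forall>i\<in>W m. t' i = s i) \<and> W m = {i\<in>J. E (x m) (t' i)}"
        using spec[OF agree, of m] m unfolding upd by blast
      then show "\<forall>i\<in>W m. t' i = t i" using s_t[OF mk] by metis
      from agree_m show "W m = {i\<in>J. E (x m) (t' i)}" ..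
    qed
    moreover from l consider "l < k" | "l = k" by linarith
    ultimately show "card ((W(k := N s)) l) \<le> card {i \<in> J. E ((x(k := y)) l) (t' i)}"
      using minimal[of l t'] s_min[of t'] by cases (auto simp: N_def)
  qed
  then show ?thesis by blast
qed

text \<open>
  Haxell's theorem, by induction on the number of parts. If a transversal of \<open>J\<close> could not be
  replaced by one that also covers the new part \<open>a\<close>, there would be arbitrarily many blocks, although
  they are nonempty disjoint subsets of \<open>J\<close>. Indeed, if \<open>k\<close> blocks comprise \<open>s \<ge> k\<close> parts, then the
  \<open>x l\<close> and the chosen vertices of the blocks are at most \<open>k + s \<le> 2 s\<close> vertices. They have at most
  \<open>2 s d\<close> neighbours, fewer than the vertices of those \<open>s\<close> parts and \<open>a\<close>, so that one of the latter
  starts another block.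
\<close>
theorem haxell:
  assumes "finite I" "symp E" "disjoint_family_on V I"
    and "\<And>i. i \<in> I \<Longrightarrow> finite (V i)" "\<And>i. i \<in> I \<Longrightarrow> V i \<noteq> {}" "\<And>i. i \<in> I \<Longrightarrow> 2 * d \<le> card (V i)"
    and "\<And>u. u \<in> \<Union>(V ` I) \<Longrightarrow> card {v \<in> \<Union>(V ` I). E u v} \<le> d"
  shows "\<exists>t. indep_transversal E V I t"
  using assms
proof (induction I rule: finite_induct)
  case empty
  then show ?case by (simp add: indep_transversal_def)
next
  case (insert a J)
  let ?X = "\<Union>(V ` insert a J)"
  \<comment> \<open>For \<open>d = 0\<close> the lower bound \<open>2 * d\<close> on the size of a part does not make it nonempty.\<close>
  let ?m = "max 1 (2 * d)"
  have finX: "finite ?X" using insert.hyps(1) insert.prems(3) by blast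
  have deg: "card {v \<in> \<Union>(V ` S). E u v} \<le> d" if "u \<in> ?X" "S \<subseteq> insert a J" for u S
  proof -
    have "{v \<in> \<Union>(V ` S). E u v} \<subseteq> {v \<in> ?X. E u v}" using that(2) by blast
    then have "card {v \<in> \<Union>(V ` S). E u v} \<le> card {v \<in> ?X. E u v}"
      using finX by (intro card_mono) (rule finite_subset[of _ ?X], blast+)
    also have "\<dots> \<le> d" using that(1) by (rule insert.prems(6))
    finally show ?thesis .
  qed
  have "\<exists>t. indep_transversal E V J t"
  proof (rule insert.IH)
    show "disjoint_family_on V J"
      using insert.prems(2) by (rule disjoint_family_on_mono[rotated]) blast
    show "card {v \<in> \<Union>(V ` J). E u v} \<le> d" if "u \<in> \<Union>(V ` J)" for u
      using deg[of u J] that by blast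
  qed (use insert.prems in auto)
  then obtain t0 where t0: "indep_transversal E V J t0" ..
  show ?case
  proof (rule ccontr)
    assume none: "\<not> ?case"
    have "\<exists>x W t. alternating_blocks E V J ?X k x W t" for k
    proof (induction k)
      case 0
      show ?case using t0 by (auto simp: alternating_blocks_def disjoint_family_on_def)
    next
      case (Suc k)
      then obtain x W t where blocks: "alternating_blocks E V J ?X k x W t" by blast
      let ?U = "\<Union>(W ` {..<k})"
      note U = alternating_blocks_card[OF blocks insert.hyps(1)]
      have finU: "finite ?U" using U(2) insert.hyps(1) by (rule finite_subset)
      have aU: "a \<notin> ?U" using U(2) insert.hyps(2) by blast
      have D: "x ` {..<k} \<union> t ` ?U \<subseteq> ?X"
        using blocks U(2) unfolding alternating_blocks_def indep_transversal_def by blast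
      have "card (x ` {..<k} \<union> t ` ?U) \<le> card (x ` {..<k}) + card (t ` ?U)" by (rule card_Un_le)
      also have "\<dots> \<le> k + card ?U"
        using card_image_le[of "{..<k}" x] card_image_le[OF finU, of t] by simp
      also have "\<dots> \<le> 2 * card ?U" using U(1) by simp
      finally have "card (x ` {..<k} \<union> t ` ?U) * d \<le> card ?U * (2 * d)"
        using mult_le_mono1[of _ _ d] by (metis mult.assoc mult.commute)
      also have "\<dots> \<le> card ?U * ?m" by simp
      also have "\<dots> < card (insert a ?U) * ?m" using finU aU by simp
      finally have less: "card (x ` {..<k} \<union> t ` ?U) * d < card (insert a ?U) * ?m" .
      have "\<exists>v\<in>\<Union>(V ` insert a ?U). \<forall>u\<in>x ` {..<k} \<union> t ` ?U. \<not> E u v"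
      proof (rule ex_undominated[OF _ _ _ _ _ less])
        show "disjoint_family_on V (insert a ?U)"
          using insert.prems(2) by (rule disjoint_family_on_mono[rotated]) (use U(2) in blast)
        show "finite (V i) \<and> ?m \<le> card (V i)" if "i \<in> insert a ?U" for i
        proof -
          have "i \<in> insert a J" using that U(2) by blast
          then have "finite (V i)" "V i \<noteq> {}" "2 * d \<le> card (V i)" using insert.prems by blast+
          then show ?thesis by (simp add: Suc_le_eq card_gt_0_iff)
        qed
        show "card {v \<in> \<Union>(V ` insert a ?U). E u v} \<le> d" if "u \<in> x ` {..<k} \<union> t ` ?U" for u
          using that D U(2) by (intro deg) blast+
      qed (use finU in auto)
      then obtain i y where "i \<in> insert a ?U" "y \<in> V i"
        and undom: "\<forall>u\<in>x ` {..<k} \<union> t ` ?U. \<not> E u y" by blast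
      moreover have "y \<in> ?X" using calculation U(2) by blast
      ultimately show ?case
        using undom by (intro alternating_blocks_extend[OF blocks insert.hyps(1) insert.prems(1) none]) auto
    qed
    then obtain x W t where "alternating_blocks E V J ?X (Suc (card J)) x W t" by blast
    note U = alternating_blocks_card[OF this insert.hyps(1)]
    show False using U(1) card_mono[OF insert.hyps(1) U(2)] by simp
  qed
qed

section \<open>Maximum cliques\<close>

text \<open>The cliques of maximum size, as opposed to those maximal under inclusion.\<close>
abbreviation max_cliques :: "'a pair_pre_digraph \<Rightarrow> 'a set set" where
  "max_cliques G \<equiv> {K. is_clique G K \<and> card K = clique_number G}"

text \<open>The open neighbourhood of a vertex.\<close>
abbreviation neighbours :: "'a pair_pre_digraph \<Rightarrow> 'a \<Rightarrow> 'a set" where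
  "neighbours G v \<equiv> {w. (v, w) \<in> parcs G}"

context pair_graph
begin

lemma parcs_sym: "(u, v) \<in> parcs G \<Longrightarrow> (v, u) \<in> parcs G"
  using pair_sym_arcs unfolding symmetric_def with_proj_simps by (rule symD)

lemma finite_neighbours: "finite (neighbours G v)"
  using pair_finite_verts by (rule finite_subset[rotated]) (auto dest: in_arcsD2)

lemma finite_cliques: "finite {K. is_clique G K}"
  using pair_finite_verts by (auto simp: is_clique_def intro: finite_subset[of _ "Pow (pverts G)"])

lemma clique_finite: "is_clique G K \<Longrightarrow> finite K"
  unfolding is_clique_def using pair_finite_verts by (blast intro: finite_subset)

lemma clique_card_le: "is_clique G K \<Longrightarrow> card K \<le> clique_number G"
  unfolding clique_number_def using finite_cliques by (intro Max_ge) auto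

lemma ex_max_clique: "max_cliques G \<noteq> {}"
proof -
  have "is_clique G {}" by (simp add: is_clique_def)
  then have "clique_number G \<in> card ` {K. is_clique G K}"
    unfolding clique_number_def using finite_cliques by (intro Max_in) auto
  then show ?thesis by auto
qed

lemma out_degree_eq_card_neighbours: "out_degree (with_proj G) v = card (neighbours G v)"
proof -
  have "out_arcs (with_proj G) v = Pair v ` neighbours G v" by (auto simp: out_arcs_def)
  then show ?thesis by (simp add: out_degree_def card_image inj_on_def)
qed

lemma card_neighbours_le: "card (neighbours G v) \<le> max_degree G"
proof (cases "v \<in> pverts G")
  case True
  then show ?thesis
    unfolding max_degree_def out_degree_eq_card_neighbours[symmetric]
    using pair_finite_verts by (intro Max_ge) auto
next
  case False
  then have "neighbours G v = {}" by (auto dest: in_arcsD1)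
  then show ?thesis by simp
qed

lemma max_degree_le:
  assumes "\<And>v. v \<in> pverts G \<Longrightarrow> card (neighbours G v) \<le> d"
  shows "max_degree G \<le> d"
  using assms pair_finite_verts by (simp add: max_degree_def out_degree_eq_card_neighbours)

lemma clique_Union_subset_neighbours:
  assumes "\<And>K. K \<in> Q \<Longrightarrow> is_clique G K" "v \<in> \<Inter>Q"
  shows "\<Union>Q - {v} \<subseteq> neighbours G v"
proof
  fix w assume "w \<in> \<Union>Q - {v}"
  then obtain K where "K \<in> Q" "w \<in> K" "v \<noteq> w" by blast
  moreover have "v \<in> K" using assms(2) \<open>K \<in> Q\<close> by blast
  ultimately show "w \<in> neighbours G v" using assms(1)[of K] by (simp add: is_clique_def)
qed

lemma card_Union_cliques_le:
  assumes "\<And>K. K \<in> Q \<Longrightarrow> is_clique G K" "v \<in> \<Inter>Q"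
  shows "card (\<Union>Q) \<le> max_degree G + 1"
proof -
  have "card (\<Union>Q) \<le> card (insert v (neighbours G v))"
    using clique_Union_subset_neighbours[OF assms] finite_neighbours by (intro card_mono) auto
  also have "\<dots> \<le> Suc (card (neighbours G v))" using finite_neighbours by (simp add: card_insert_if)
  also have "\<dots> \<le> max_degree G + 1" using card_neighbours_le by simp
  finally show ?thesis .
qed

text \<open>
  Hajnal's lemma. For a further maximum clique \<open>K\<close>, the set \<open>\<Inter>Q \<union> (K \<inter> \<Union>Q)\<close> is again a clique,
  and comparing its size with that of \<open>K\<close> gives the induction step.
\<close>
lemma hajnal:
  assumes "finite Q" "Q \<noteq> {}" "Q \<subseteq> max_cliques G"
  shows "2 * clique_number G \<le> card (\<Inter>Q) + card (\<Union>Q)"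
  using assms
proof (induction Q rule: finite_ne_induct)
  case (singleton K)
  then show ?case by simp
next
  case (insert K Q)
  let ?C = "\<Inter>Q \<union> (K \<inter> \<Union>Q)"
  have cl: "is_clique G L" if "L \<in> insert K Q" for L using insert.prems that by blast
  then have finU: "finite (\<Union>Q)" and finK: "finite K"
    using insert.hyps(1) clique_finite by auto
  have finI: "finite (\<Inter>Q)" using finU insert.hyps(2) by (auto intro: finite_subset[of _ "\<Union>Q"])
  have adj: "(u, v) \<in> parcs G" if "u \<in> \<Inter>Q" "v \<in> \<Union>Q" "u \<noteq> v" for u v
    using that cl unfolding is_clique_def by blast
  have "is_clique G ?C"
    unfolding is_clique_def
  proof (intro conjI ballI impI)
    show "?C \<subseteq> pverts G" using cl insert.hyps(2) unfolding is_clique_def by blast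
    fix u v assume uv: "u \<in> ?C" "v \<in> ?C" "u \<noteq> v"
    have "\<Inter>Q \<subseteq> \<Union>Q" using insert.hyps(2) by blast
    then consider "u \<in> \<Inter>Q" "v \<in> \<Union>Q" | "v \<in> \<Inter>Q" "u \<in> \<Union>Q" | "u \<in> K" "v \<in> K"
      using uv by blast
    then show "(u, v) \<in> parcs G"
    proof cases
      case 3
      then show ?thesis using cl uv unfolding is_clique_def by blast
    qed (use adj parcs_sym uv in blast)+
  qed
  then have "card ?C \<le> clique_number G" by (rule clique_card_le)
  moreover have "card ?C + card (\<Inter>Q \<inter> (K \<inter> \<Union>Q)) = card (\<Inter>Q) + card (K \<inter> \<Union>Q)"
    using card_Un_Int[of "\<Inter>Q" "K \<inter> \<Union>Q"] finI finK by simp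
  moreover have "\<Inter>Q \<inter> (K \<inter> \<Union>Q) = \<Inter>(insert K Q)" using insert.hyps(2) by blast
  then have "card (\<Inter>Q \<inter> (K \<inter> \<Union>Q)) = card (\<Inter>(insert K Q))" by (rule arg_cong)
  moreover have "card K + card (\<Union>Q) = card (\<Union>(insert K Q)) + card (K \<inter> \<Union>Q)"
    using card_Un_Int[OF finK finU] by simp
  moreover have "card K = clique_number G" "2 * clique_number G \<le> card (\<Inter>Q) + card (\<Union>Q)"
    using insert by auto
  ultimately show ?case by linarith
qed

lemma card_Inter_max_cliques_ge:
  assumes "finite Q" "Q \<noteq> {}" "Q \<subseteq> max_cliques G" "\<Inter>Q \<noteq> {}"
  shows "2 * clique_number G \<le> card (\<Inter>Q) + max_degree G + 1"
proof -
  obtain v where "v \<in> \<Inter>Q" using assms(4) by blast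
  then have "card (\<Union>Q) \<le> max_degree G + 1" using assms(3) by (intro card_Union_cliques_le) auto
  then show ?thesis using hajnal[OF assms(1-3)] by linarith
qed

text \<open>
  Two subsets of a maximum clique that both contain at least \<open>2\<omega> - (\<Delta> + 1)\<close> vertices meet
  as soon as \<open>\<omega> > 2 (\<Delta> + 1) / 3\<close>; this drives both parts of Kostochka's argument below.
\<close>
lemma large_subsets_meet:
  assumes "2 * max_degree G + 2 < 3 * clique_number G" "is_clique G L" "A \<subseteq> L" "B \<subseteq> L"
    and "2 * clique_number G \<le> card A + max_degree G + 1"
    and "2 * clique_number G \<le> card B + max_degree G + 1"
  shows "A \<inter> B \<noteq> {}"
proof
  assume "A \<inter> B = {}"
  then have "card A + card B = card (A \<union> B)"
    using clique_finite[OF assms(2)] assms(3,4) by (metis card_Un_disjoint finite_subset)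
  also have "\<dots> \<le> card L" using clique_finite[OF assms(2)] assms(3,4) by (intro card_mono) auto
  also have "\<dots> \<le> clique_number G" using assms(2) by (rule clique_card_le)
  finally show False using assms by linarith
qed

lemma max_cliques_meet_trans:
  assumes "2 * max_degree G + 2 < 3 * clique_number G"
    and "{K, L, M} \<subseteq> max_cliques G" "K \<inter> L \<noteq> {}" "L \<inter> M \<noteq> {}"
  shows "K \<inter> M \<noteq> {}"
proof -
  have "(K \<inter> L) \<inter> (L \<inter> M) \<noteq> {}"
    using card_Inter_max_cliques_ge[of "{K, L}"] card_Inter_max_cliques_ge[of "{L, M}"] assms
    by (intro large_subsets_meet[of L]) auto
  then show ?thesis by blast
qed

text \<open>Kostochka's lemma, for pairwise intersecting maximum cliques.\<close>
lemma kostochka: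
  assumes "2 * max_degree G + 2 < 3 * clique_number G"
    and "finite Q" "Q \<noteq> {}" "Q \<subseteq> max_cliques G" "\<And>K L. K \<in> Q \<Longrightarrow> L \<in> Q \<Longrightarrow> K \<inter> L \<noteq> {}"
  shows "\<Inter>Q \<noteq> {}"
  using assms(2-)
proof (induction Q rule: finite_ne_induct)
  case (singleton K)
  then show ?case by auto
next
  case (insert K Q)
  obtain L where L: "L \<in> Q" using insert.hyps(2) by blast
  have "\<Inter>Q \<noteq> {}" using insert.prems by (intro insert.IH) auto
  then have "2 * clique_number G \<le> card (\<Inter>Q) + max_degree G + 1"
    using insert.prems insert.hyps by (intro card_Inter_max_cliques_ge) auto
  moreover have "2 * clique_number G \<le> card (K \<inter> L) + max_degree G + 1"
    using card_Inter_max_cliques_ge[of "{K, L}"] insert.prems L by auto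
  ultimately have "\<Inter>Q \<inter> (K \<inter> L) \<noteq> {}"
    using L insert.prems assms(1) by (intro large_subsets_meet[of L]) auto
  then show ?case by auto
qed

section \<open>An independent set meeting every maximum clique\<close>

text \<open>Independent vertex sets of \<open>G\<close>.\<close>
definition independent :: "'a set \<Rightarrow> bool" where
  "independent I \<longleftrightarrow> I \<subseteq> pverts G \<and> (\<forall>u\<in>I. \<forall>v\<in>I. (u, v) \<notin> parcs G)"

text \<open>
  Rabern's theorem. When the maximum cliques are grouped into classes \<open>c\<close> of intersecting cliques,
  each \<open>\<Inter>c\<close> has at least \<open>2\<omega> - (\<Delta> + 1)\<close> vertices, and each of these has at most
  \<open>\<Delta> + 1 - \<omega>\<close> neighbours outside \<open>\<Union>c\<close>. The hypothesis says exactly that the first number is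
  at least twice the second, so that the sets \<open>\<Inter>c\<close> have an independent transversal.
\<close>
theorem ex_independent_hitting_max_cliques:
  assumes "3 * max_degree G + 3 \<le> 4 * clique_number G"
  shows "\<exists>I. independent I \<and> (\<forall>K\<in>max_cliques G. K \<inter> I \<noteq> {})"
proof -
  let ?Q = "max_cliques G"
  define d where "d = max_degree G + 1 - clique_number G"
  define C where "C K = {L \<in> ?Q. K \<inter> L \<noteq> {}}" for K
  define P where "P = C ` ?Q"
  \<comment> \<open>The edges inside a set \<open>\<Inter>c\<close>, which is a clique, are left out to keep the degrees small.\<close>
  define E where "E u v \<longleftrightarrow> (u, v) \<in> parcs G \<and> \<not> (\<exists>c\<in>P. u \<in> \<Inter>c \<and> v \<in> \<Inter>c)" for u v
  have big: "2 * max_degree G + 2 < 3 * clique_number G" and pos: "0 < clique_number G"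
    using assms by linarith+
  have finQ: "finite ?Q" using finite_cliques by (rule finite_subset[rotated]) blast
  have self: "K \<in> C K" if "K \<in> ?Q" for K
    using that pos by (auto simp: C_def)
  have meet_trans: "K \<inter> M \<noteq> {}"
    if "K \<in> ?Q" "L \<in> ?Q" "M \<in> ?Q" "K \<inter> L \<noteq> {}" "L \<inter> M \<noteq> {}" for K L M
    using that by (intro max_cliques_meet_trans[OF big, of K L M]) simp_all
  have C_eq: "C K = C L" if "K \<in> ?Q" "L \<in> ?Q" "K \<inter> L \<noteq> {}" for K L
  proof -
    have sub: "C A \<subseteq> C B" if "A \<in> ?Q" "B \<in> ?Q" "A \<inter> B \<noteq> {}" for A B
    proof
      fix M assume "M \<in> C A"
      then have M: "M \<in> ?Q" "A \<inter> M \<noteq> {}" by (simp_all add: C_def)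
      have "B \<inter> A \<noteq> {}" using that(3) by blast
      then have "B \<inter> M \<noteq> {}" using meet_trans[of B A M] that M by blast
      then show "M \<in> C B" using M by (simp add: C_def)
    qed
    have "L \<inter> K \<noteq> {}" using that(3) by blast
    then show ?thesis using sub[of K L] sub[of L K] that by blast
  qed
  have P_D: "finite c" "c \<noteq> {}" "c \<subseteq> ?Q" if "c \<in> P" for c
  proof -
    obtain K where K: "K \<in> ?Q" "c = C K" using \<open>c \<in> P\<close> unfolding P_def by blast
    show "c \<subseteq> ?Q" unfolding K(2) C_def by blast
    then show "finite c" using finQ by (rule finite_subset)
    show "c \<noteq> {}" using self[OF K(1)] K(2) by blast
  qed
  have P_eq: "c = C K" if "c \<in> P" "K \<in> c" for c K
  proof -
    obtain L where L: "L \<in> ?Q" "c = C L" using \<open>c \<in> P\<close> unfolding P_def by blast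
    then have "K \<in> ?Q" "L \<inter> K \<noteq> {}" using that(2) by (simp_all add: C_def)
    then show ?thesis using C_eq[of L K] L by simp
  qed
  have same: "c = c'" if "c \<in> P" "c' \<in> P" "v \<in> \<Union>c" "v \<in> \<Union>c'" for c c' v
  proof -
    obtain K L where KL: "K \<in> c" "L \<in> c'" "K \<inter> L \<noteq> {}" using \<open>v \<in> \<Union>c\<close> \<open>v \<in> \<Union>c'\<close> by blast
    then have "C K = C L" using P_D(3)[OF that(1)] P_D(3)[OF that(2)] by (intro C_eq) blast+
    then show ?thesis using P_eq[OF that(1) KL(1)] P_eq[OF that(2) KL(2)] by simp
  qed
  have Inter_Union: "\<Inter>c \<subseteq> \<Union>c" if "c \<in> P" for c using P_D(2)[OF that] by blast
  have Inter_ne: "\<Inter>c \<noteq> {}" if "c \<in> P" for c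
  proof (rule kostochka[OF big P_D[OF that]])
    fix K L assume "K \<in> c" "L \<in> c"
    then have "L \<in> C K" using P_eq[OF that, of K] by simp
    then show "K \<inter> L \<noteq> {}" by (simp add: C_def)
  qed
  have "\<exists>t. indep_transversal E Inter P t"
  proof (rule haxell)
    show "finite P" unfolding P_def using finQ by (rule finite_imageI)
    show "symp E" by (rule sympI) (auto simp: E_def dest: parcs_sym)
    show "disjoint_family_on Inter P"
      unfolding disjoint_family_on_def
    proof (intro ballI impI)
      fix c c' assume cc: "c \<in> P" "c' \<in> P" "c \<noteq> c'"
      show "\<Inter>c \<inter> \<Inter>c' = {}"
      proof (rule equals0I)
        fix v assume "v \<in> \<Inter>c \<inter> \<Inter>c'"
        then show False
          using same[OF cc(1,2), of v] Inter_Union[OF cc(1)] Inter_Union[OF cc(2)] cc(3) by blast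
      qed
    qed
  next
    fix c assume c: "c \<in> P"
    show "\<Inter>c \<noteq> {}" using c by (rule Inter_ne)
    have "2 * clique_number G \<le> card (\<Inter>c) + max_degree G + 1"
      using P_D[OF c] Inter_ne[OF c] by (rule card_Inter_max_cliques_ge)
    then show "2 * d \<le> card (\<Inter>c)" using assms unfolding d_def by linarith
    obtain K where "K \<in> c" using P_D(2)[OF c] by blast
    then have "finite K" "\<Inter>c \<subseteq> K" using P_D(3)[OF c] clique_finite by blast+
    then show "finite (\<Inter>c)" by (metis finite_subset)
  next
    fix u assume "u \<in> \<Union>(Inter ` P)"
    then obtain c where c: "c \<in> P" "u \<in> \<Inter>c" by blast
    obtain K where "K \<in> c" using P_D(2)[OF c(1)] by blast
    then have K: "is_clique G K" "card K = clique_number G" "u \<in> K" using P_D(3)[OF c(1)] c(2) by blast+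
    have "v \<notin> K" if v: "v \<in> \<Inter>c'" "c' \<in> P" "E u v" for v c'
    proof
      assume "v \<in> K"
      then have "c = c'" using same[of c c' v] c(1) v Inter_Union[OF v(2)] \<open>K \<in> c\<close> by blast
      then show False using v c unfolding E_def by blast
    qed
    then have "{v \<in> \<Union>(Inter ` P). E u v} \<subseteq> neighbours G u - (K - {u})" unfolding E_def by blast
    then have "card {v \<in> \<Union>(Inter ` P). E u v} \<le> card (neighbours G u - (K - {u}))"
      using finite_neighbours by (intro card_mono) simp_all
    also have "K - {u} \<subseteq> neighbours G u" using K(1,3) by (auto simp: is_clique_def)
    then have "card (neighbours G u - (K - {u})) = card (neighbours G u) - (clique_number G - 1)"
      using K clique_finite[OF K(1)] by (simp add: card_Diff_subset)
    also have "\<dots> \<le> d" using card_neighbours_le[of u] pos unfolding d_def by linarith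
    finally show "card {v \<in> \<Union>(Inter ` P). E u v} \<le> d" .
  qed
  then obtain t where "indep_transversal E Inter P t" ..
  then have t: "t c \<in> \<Inter>c" and t_indep: "c' \<in> P \<Longrightarrow> c \<noteq> c' \<Longrightarrow> \<not> E (t c) (t c')" if "c \<in> P" for c c'
    using that unfolding indep_transversal_def by simp_all
  have "independent (t ` P)"
    unfolding independent_def
  proof (intro conjI ballI)
    show "t ` P \<subseteq> pverts G"
    proof (rule image_subsetI)
      fix c assume c: "c \<in> P"
      then obtain K where "K \<in> c" using P_D(2) by blast
      then have "t c \<in> K" "is_clique G K" using t[OF c] P_D(3)[OF c] by blast+
      then show "t c \<in> pverts G" unfolding is_clique_def by blast
    qed
    fix u v assume "u \<in> t ` P" "v \<in> t ` P"
    then obtain c c' where c: "c \<in> P" "u = t c" and c': "c' \<in> P" "v = t c'" by blast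
    show "(u, v) \<notin> parcs G"
    proof
      assume arc: "(u, v) \<in> parcs G"
      then have "c \<noteq> c'" using pair_no_loops[OF arc] c c' by auto
      then have "\<not> E u v" using t_indep c c' by blast
      then obtain b where b: "b \<in> P" "u \<in> \<Inter>b" "v \<in> \<Inter>b" using arc unfolding E_def by blast
      have "b = c" using same[of b c u] b c t[OF c(1)] Inter_Union by blast
      moreover have "b = c'" using same[of b c' v] b c' t[OF c'(1)] Inter_Union by blast
      ultimately show False using \<open>c \<noteq> c'\<close> by simp
    qed
  qed
  moreover have "K \<inter> t ` P \<noteq> {}" if K: "K \<in> ?Q" for K
  proof -
    have "C K \<in> P" using K unfolding P_def by (rule imageI)
    then show ?thesis using t[of "C K"] self[OF K] by blast
  qed
  ultimately show ?thesis by blast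
qed

lemma ex_maximal_independent:
  assumes "independent I"
  shows "\<exists>J. independent J \<and> I \<subseteq> J \<and> (\<forall>v\<in>pverts G - J. \<exists>u\<in>J. (v, u) \<in> parcs G)"
proof -
  have "finite {J. independent J}"
    using pair_finite_verts by (auto simp: independent_def intro: finite_subset[of _ "Pow (pverts G)"])
  from finite_has_maximal2[OF this, of I] assms
  obtain J where J: "independent J" "I \<subseteq> J" and max: "\<And>B. independent B \<Longrightarrow> J \<subseteq> B \<Longrightarrow> J = B"
    by auto
  have "\<exists>u\<in>J. (v, u) \<in> parcs G" if v: "v \<in> pverts G - J" for v
  proof (rule ccontr)
    assume none: "\<not> ?thesis"
    then have "(u, v) \<notin> parcs G" if "u \<in> J" for u using that parcs_sym by blast
    moreover have "(v, v) \<notin> parcs G" using pair_no_loops by fastforce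
    ultimately have "independent (insert v J)" using J(1) v none by (simp add: independent_def)
    then show False using max[of "insert v J"] v by blast
  qed
  then show ?thesis using J by blast
qed

section \<open>Removing an independent set\<close>

text \<open>The \<open>LEAST\<close> in the chromatic number is attained: colouring injectively is proper.\<close>
lemma ex_proper_colouring: "\<exists>c. proper_colouring G (chromatic_number G) c"
proof -
  obtain c where "bij_betw c (pverts G) {0..<card (pverts G)}"
    using ex_bij_betw_finite_nat[OF pair_finite_verts] by blast
  then have c: "inj_on c (pverts G)" "c ` pverts G = {0..<card (pverts G)}"
    by (simp_all add: bij_betw_def)
  have "c u \<noteq> c v" if "(u, v) \<in> parcs G" for u v
    using that c(1) in_arcsD1[OF that] in_arcsD2[OF that] pair_no_loops[OF that]
    by (auto dest: inj_onD)
  then have "proper_colouring G (card (pverts G)) c"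
    using c(2) unfolding proper_colouring_def by auto
  then have "\<exists>k c. proper_colouring G k c" by blast
  then show ?thesis unfolding chromatic_number_def by (rule LeastI_ex)
qed

lemma chromatic_number_le: "proper_colouring G k c \<Longrightarrow> chromatic_number G \<le> k"
  unfolding chromatic_number_def by (blast intro: Least_le)

text \<open>The graph \<open>G - I\<close>, that is, the subgraph induced on the vertices outside \<open>I\<close>.\<close>
definition delete_verts :: "'a set \<Rightarrow> 'a pair_pre_digraph" where
  "delete_verts I = \<lparr>pverts = pverts G - I, parcs = parcs G \<inter> (- I) \<times> (- I)\<rparr>"

lemma pair_graph_delete_verts: "pair_graph (delete_verts I)"
proof -
  have "sym (parcs G \<inter> (- I) \<times> (- I))" by (rule symI) (auto dest: parcs_sym)
  then show ?thesis
    by unfold_locales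
      (use pair_finite_verts pair_finite_arcs arc_fst_in_verts arc_snd_in_verts pair_no_loops
        in \<open>auto simp: delete_verts_def symmetric_def\<close>)
qed

lemma chromatic_number_delete_independent:
  assumes "independent I"
  shows "chromatic_number G \<le> chromatic_number (delete_verts I) + 1"
proof -
  let ?k = "chromatic_number (delete_verts I)"
  obtain c where c: "proper_colouring (delete_verts I) ?k c"
    using pair_graph.ex_proper_colouring[OF pair_graph_delete_verts] by blast
  have less: "c v < ?k" if "v \<in> pverts G - I" for v
    using c that by (simp add: proper_colouring_def delete_verts_def)
  have ne: "c u \<noteq> c v" if "(u, v) \<in> parcs G" "u \<notin> I" "v \<notin> I" for u v
    using c that by (auto simp: proper_colouring_def delete_verts_def)
  let ?c = "\<lambda>v. if v \<in> I then ?k else c v"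
  have "?c u \<noteq> ?c v" if arc: "(u, v) \<in> parcs G" for u v
  proof -
    have "\<not> (u \<in> I \<and> v \<in> I)" using assms arc unfolding independent_def by blast
    then show ?thesis
      using ne[OF arc] less[of u] less[of v] in_arcsD1[OF arc] in_arcsD2[OF arc] by auto
  qed
  moreover have "?c v < ?k + 1" if "v \<in> pverts G" for v using less[of v] that by auto
  ultimately have "proper_colouring G (?k + 1) ?c" unfolding proper_colouring_def by blast
  then show ?thesis by (rule chromatic_number_le)
qed

lemma clique_number_delete_hitting:
  assumes "\<And>K. K \<in> max_cliques G \<Longrightarrow> K \<inter> I \<noteq> {}"
  shows "clique_number (delete_verts I) < clique_number G"
proof -
  obtain K where K: "is_clique (delete_verts I) K" "card K = clique_number (delete_verts I)"
    using pair_graph.ex_max_clique[OF pair_graph_delete_verts] by blast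
  then have "is_clique G K" "K \<inter> I = {}" by (auto simp: is_clique_def delete_verts_def)
  then have "card K \<le> clique_number G" "card K \<noteq> clique_number G"
    using clique_card_le assms by blast+
  then show ?thesis using K(2) by simp
qed

lemma max_degree_delete_dominating:
  assumes "\<And>v. v \<in> pverts G - I \<Longrightarrow> \<exists>u\<in>I. (v, u) \<in> parcs G" "pverts G - I \<noteq> {}"
  shows "max_degree (delete_verts I) < max_degree G"
proof -
  have less: "card (neighbours (delete_verts I) v) < max_degree G" if v: "v \<in> pverts G - I" for v
  proof -
    obtain u where "u \<in> I" "(v, u) \<in> parcs G" using assms(1)[OF v] by blast
    then have "neighbours (delete_verts I) v \<subset> neighbours G v" by (auto simp: delete_verts_def)
    then have "card (neighbours (delete_verts I) v) < card (neighbours G v)"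
      using finite_neighbours by (rule psubset_card_mono[rotated])
    then show ?thesis using card_neighbours_le[of v] by linarith
  qed
  then have "max_degree (delete_verts I) \<le> max_degree G - 1"
    by (intro pair_graph.max_degree_le[OF pair_graph_delete_verts])
      (fastforce simp: delete_verts_def)
  moreover have "0 < max_degree G" using less assms(2) by fastforce
  ultimately show ?thesis by linarith
qed

text \<open>
  Deleting a maximal independent set that meets every maximum clique costs one colour. If vertices
  remain, it lowers both \<open>\<omega>\<close> and \<open>\<Delta>\<close>, hence Reed's bound, by at least one. If none remain, the
  graph has no edges and one colour suffices.
\<close>
lemma satisfies_reed_if_smaller:
  assumes large: "3 * max_degree G + 3 \<le> 4 * clique_number G"
    and smaller: "\<And>H :: 'a pair_pre_digraph.
      pair_graph H \<Longrightarrow> card (pverts H) < card (pverts G) \<Longrightarrow> satisfies_reed H"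
  shows "satisfies_reed G"
proof -
  obtain I0 where I0: "independent I0" "\<And>K. K \<in> max_cliques G \<Longrightarrow> K \<inter> I0 \<noteq> {}"
    using ex_independent_hitting_max_cliques[OF large] by blast
  obtain I where I: "independent I" "I0 \<subseteq> I"
    and dom: "\<And>v. v \<in> pverts G - I \<Longrightarrow> \<exists>u\<in>I. (v, u) \<in> parcs G"
    using ex_maximal_independent[OF I0(1)] by blast
  have hit: "K \<inter> I \<noteq> {}" if "K \<in> max_cliques G" for K using I0(2)[OF that] I(2) by blast
  show ?thesis
  proof (cases "pverts G - I = {}")
    case True
    have "proper_colouring G 1 (\<lambda>_. 0)"
      using I(1) True in_arcsD1 in_arcsD2 unfolding proper_colouring_def independent_def by blast
    then have "int (chromatic_number G) \<le> 1" using chromatic_number_le by fastforce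
    also have "1 \<le> \<lceil>(real (clique_number G) + real (max_degree G) + 1) / 2\<rceil>"
      using large by (simp add: one_le_ceiling)
    finally show ?thesis unfolding satisfies_reed_def .
  next
    case False
    let ?H = "delete_verts I"
    have "I \<noteq> {}" using hit ex_max_clique by blast
    then have "pverts ?H \<subset> pverts G" using I(1) by (auto simp: delete_verts_def independent_def)
    then have "card (pverts ?H) < card (pverts G)" using pair_finite_verts by (rule psubset_card_mono[rotated])
    then have "satisfies_reed ?H" using smaller pair_graph_delete_verts by blast
    moreover have "clique_number ?H < clique_number G" using hit by (rule clique_number_delete_hitting)
    moreover have "max_degree ?H < max_degree G" using dom False by (rule max_degree_delete_dominating)
    ultimately have "int (chromatic_number ?H) \<le> \<lceil>(real (clique_number ?H) + real (max_degree ?H) + 1) / 2\<rceil>"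
      and "real (clique_number ?H) + 1 \<le> real (clique_number G)" "real (max_degree ?H) + 1 \<le> real (max_degree G)"
      unfolding satisfies_reed_def by linarith+
    moreover from this(2,3)
    have "\<lceil>(real (clique_number ?H) + real (max_degree ?H) + 1) / 2 + 1\<rceil>
        \<le> \<lceil>(real (clique_number G) + real (max_degree G) + 1) / 2\<rceil>"
      by (intro ceiling_mono) (simp add: field_simps)
    ultimately have "int (chromatic_number ?H) + 1 \<le> \<lceil>(real (clique_number G) + real (max_degree G) + 1) / 2\<rceil>"
      by linarith
    then show ?thesis
      using chromatic_number_delete_independent[OF I(1)] unfolding satisfies_reed_def by linarith
  qed
qed

end

theorem mainTheorem3:
  fixes G :: "'a pair_pre_digraph"
  assumes "minimum_reed_counterexample G"
  shows "real (clique_number G) < 3 / 4 * (real (max_degree G) + 1)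
    \<and> int (chromatic_number G) > \<lceil>7 / 6 * real (clique_number G)\<rceil>"
proof
  interpret pair_graph G using assms unfolding minimum_reed_counterexample_def by blast
  have not_reed: "\<not> satisfies_reed G"
    and smaller: "\<And>H :: 'a pair_pre_digraph.
      pair_graph H \<Longrightarrow> card (pverts H) < card (pverts G) \<Longrightarrow> satisfies_reed H"
    using assms unfolding minimum_reed_counterexample_def by blast+
  have "4 * clique_number G < 3 * max_degree G + 3"
    using satisfies_reed_if_smaller smaller not_reed by (meson not_le)
  then have "real (4 * clique_number G) < real (3 * max_degree G + 3)" by (rule of_nat_less_iff[THEN iffD2])
  then show small: "real (clique_number G) < 3 / 4 * (real (max_degree G) + 1)" by (simp add: field_simps)
  have "\<lceil>7 / 6 * real (clique_number G)\<rceil> \<le> \<lceil>(real (clique_number G) + real (max_degree G) + 1) / 2\<rceil>"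
    using small by (intro ceiling_mono) (simp add: field_simps)
  also have "\<dots> < int (chromatic_number G)" using not_reed unfolding satisfies_reed_def by linarith
  finally show "int (chromatic_number G) > \<lceil>7 / 6 * real (clique_number G)\<rceil>" .
qed

end
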